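(* Let $\mathcal{C}$ be a closed symmetric monoidal category and let $\mathcal{T}$ be a one-object category enriched over $\mathcal{C}$, with hom-object $T$, composition $\mu:T\otimes T\to T$ and unit $\iota:1_{\mathcal{C}}\to T$. Let $\Omega$ be an object of $\mathcal{C}$. Then the shift morphism $\mathrm{shift}_\Omega: T\otimes[T;\Omega]\to[T;\Omega]$ is a left action of $T$ on the path space $[T;\Omega]$. Consequently it corresponds uniquely to an enriched functor $\mathcal{T}\to\mathcal{C}$ with domain $[T;\Omega]$, i.e. sending the unique object of $\mathcal{T}$ to $[T;\Omega]$.
   Context: Time: the time semigroup $\mathcal{T}$ (with identity) is viewed as a one-object category enriched over the symmetric monoidal category $\mathcal{C}$. Its hom-object $T\in\mathcal{C}$, with $\mu:T\otimes T\to T$ and $\iota:1_{\mathcal{C}}\to T$, is a monoid object ($\mu$ associative, $\iota$ two-sided unit). Associators are suppressed. Closedness: $[y;z]$ is the internal hom, with natural bijections $\mathrm{Hom}(y\otimes x;z)\cong\mathrm{Hom}(x;[y;z])$; $\mathrm{eval}:y\otimes[y;z]\to z$ is the evaluation, adjoint to $\mathrm{id}_{[y;z]}$. $\mathcal{C}$ is enriched over itself via internal homs. Shift: $\mathrm{shift}_\Omega:T\otimes[T;\Omega]\to[T;\Omega]$ is the adjoint, with respect to the first (leftmost) factor $T$, of the composite $T\otimes T\otimes[T;\Omega]\xrightarrow{\mu\otimes[T;\Omega]}T\otimes[T;\Omega]\xrightarrow{\mathrm{eval}}\Omega$. Left action: a morphism $\Psi:T\otimes X\to X$ is a left action of $T$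 on $X$ if $\Psi\circ(\iota\otimes X)$ is the canonical isomorphism $1_{\mathcal{C}}\otimes X\cong X$ and $\Psi\circ(T\otimes\Psi)=\Psi\circ(\mu\otimes X)$. Enriched functor and its correspondence with actions: an enriched functor $\mathcal{T}\to\mathcal{C}$ with domain $X$ consists of the object $X$ and a morphism $\Psi^\sharp:T\to[X;X]$ compatible with units and compositions. The correspondence sends $\Psi^\sharp$ to the morphism $\Psi:T\otimes X\to X$ adjoint to it. *)

theory Defs
  imports "HOL-Library.FuncSet"
begin

section \<open>Categories\<close>

text \<open>
  Objects and arrows live in carrier sets. Composition and all further operations are total
  functions that are only constrained on these carriers. \<open>g \<cdot> f\<close> is \<open>f\<close> followed by \<open>g\<close>.
\<close>

record ('o, 'm) category =
  Obj :: "'o set"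
  Arr :: "'m set"
  Dom :: "'m \<Rightarrow> 'o"
  Cod :: "'m \<Rightarrow> 'o"
  Ident :: "'o \<Rightarrow> 'm"  (\<open>\<I>\<index>\<close>)
  Comp :: "'m \<Rightarrow> 'm \<Rightarrow> 'm"  (infixr \<open>\<cdot>\<index>\<close> 55)

definition Hom :: "('o, 'm, 'e) category_scheme \<Rightarrow> 'o \<Rightarrow> 'o \<Rightarrow> 'm set" where
  "Hom C x y = {f \<in> Arr C. Dom C f = x \<and> Cod C f = y}"

locale category =
  fixes C :: "('o, 'm, 'e) category_scheme" (structure)
  assumes Dom_closed: "f \<in> Arr C \<Longrightarrow> Dom C f \<in> Obj C"
    and Cod_closed: "f \<in> Arr C \<Longrightarrow> Cod C f \<in> Obj C"
    and Ident_in_Hom: "x \<in> Obj C \<Longrightarrow> \<I> x \<in> Hom C x x"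
    and Comp_in_Hom: "f \<in> Hom C x y \<Longrightarrow> g \<in> Hom C y z \<Longrightarrow> g \<cdot> f \<in> Hom C x z"
    and Comp_Ident_left: "f \<in> Hom C x y \<Longrightarrow> \<I> y \<cdot> f = f"
    and Comp_Ident_right: "f \<in> Hom C x y \<Longrightarrow> f \<cdot> \<I> x = f"
    and Comp_assoc: "f \<in> Hom C w x \<Longrightarrow> g \<in> Hom C x y \<Longrightarrow> h \<in> Hom C y z
      \<Longrightarrow> (h \<cdot> g) \<cdot> f = h \<cdot> (g \<cdot> f)"

definition inverse_arrows :: "('o, 'm, 'e) category_scheme \<Rightarrow> 'm \<Rightarrow> 'm \<Rightarrow> bool" where
  "inverse_arrows C f g \<longleftrightarrow>
     f \<in> Arr C \<and> g \<in> Hom C (Cod C f) (Dom C f) \<and>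
     Comp C g f = Ident C (Dom C f) \<and> Comp C f g = Ident C (Cod C f)"

definition iso_arr :: "('o, 'm, 'e) category_scheme \<Rightarrow> 'm \<Rightarrow> bool" where
  "iso_arr C f \<longleftrightarrow> (\<exists>g. inverse_arrows C f g)"

definition inv_arr :: "('o, 'm, 'e) category_scheme \<Rightarrow> 'm \<Rightarrow> 'm" where
  "inv_arr C f = (THE g. inverse_arrows C f g)"


section \<open>Closed symmetric monoidal categories\<close>

text \<open>
  \<open>x \<otimes> y\<close> is the tensor product of objects, \<open>f \<boxtimes> g\<close> that of arrows. The monoidal structure is not
  assumed to be strict: \<open>Associator C x y z : (x \<otimes> y) \<otimes> z \<rightarrow> x \<otimes> (y \<otimes> z)\<close>.
\<close>

record ('o, 'm) monoidal_category = "('o, 'm) category" +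
  Tensor :: "'o \<Rightarrow> 'o \<Rightarrow> 'o"  (infixr \<open>\<otimes>\<index>\<close> 70)
  Tensor_arr :: "'m \<Rightarrow> 'm \<Rightarrow> 'm"  (infixr \<open>\<boxtimes>\<index>\<close> 70)
  Unit :: "'o"  (\<open>\<one>\<index>\<close>)
  Associator :: "'o \<Rightarrow> 'o \<Rightarrow> 'o \<Rightarrow> 'm"
  Left_unitor :: "'o \<Rightarrow> 'm"
  Right_unitor :: "'o \<Rightarrow> 'm"

locale monoidal_category = category C
  for C :: "('o, 'm, 'e) monoidal_category_scheme" (structure) +
  assumes Unit_closed: "\<one> \<in> Obj C"
    and Tensor_closed: "x \<in> Obj C \<Longrightarrow> y \<in> Obj C \<Longrightarrow> x \<otimes> y \<in> Obj C"
    and Tensor_arr_in_Hom: "f \<in> Hom C x x' \<Longrightarrow> g \<in> Hom C y y' \<Longrightarrow>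
      f \<boxtimes> g \<in> Hom C (x \<otimes> y) (x' \<otimes> y')"
    and Tensor_Ident: "x \<in> Obj C \<Longrightarrow> y \<in> Obj C \<Longrightarrow> \<I> x \<boxtimes> \<I> y = \<I> (x \<otimes> y)"
    and Tensor_Comp:
      "f \<in> Hom C x x' \<Longrightarrow> f' \<in> Hom C x' x'' \<Longrightarrow> g \<in> Hom C y y' \<Longrightarrow> g' \<in> Hom C y' y'' \<Longrightarrow>
        (f' \<cdot> f) \<boxtimes> (g' \<cdot> g) = (f' \<boxtimes> g') \<cdot> (f \<boxtimes> g)"
    and Associator_in_Hom: "x \<in> Obj C \<Longrightarrow> y \<in> Obj C \<Longrightarrow> z \<in> Obj C \<Longrightarrow>
      Associator C x y z \<in> Hom C ((x \<otimes> y) \<otimes> z) (x \<otimes> (y \<otimes> z))"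
    and Associator_iso: "x \<in> Obj C \<Longrightarrow> y \<in> Obj C \<Longrightarrow> z \<in> Obj C \<Longrightarrow> iso_arr C (Associator C x y z)"
    and Associator_natural:
      "f \<in> Hom C x x' \<Longrightarrow> g \<in> Hom C y y' \<Longrightarrow> h \<in> Hom C z z' \<Longrightarrow>
        Associator C x' y' z' \<cdot> ((f \<boxtimes> g) \<boxtimes> h) = (f \<boxtimes> (g \<boxtimes> h)) \<cdot> Associator C x y z"
    and Left_unitor_in_Hom: "x \<in> Obj C \<Longrightarrow> Left_unitor C x \<in> Hom C (\<one> \<otimes> x) x"
    and Left_unitor_iso: "x \<in> Obj C \<Longrightarrow> iso_arr C (Left_unitor C x)"
    and Left_unitor_natural: "f \<in> Hom C x y \<Longrightarrow>
      Left_unitor C y \<cdot> (\<I> \<one> \<boxtimes> f) = f \<cdot> Left_unitor C x"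
    and Right_unitor_in_Hom: "x \<in> Obj C \<Longrightarrow> Right_unitor C x \<in> Hom C (x \<otimes> \<one>) x"
    and Right_unitor_iso: "x \<in> Obj C \<Longrightarrow> iso_arr C (Right_unitor C x)"
    and Right_unitor_natural: "f \<in> Hom C x y \<Longrightarrow>
      Right_unitor C y \<cdot> (f \<boxtimes> \<I> \<one>) = f \<cdot> Right_unitor C x"
    and pentagon:
      "w \<in> Obj C \<Longrightarrow> x \<in> Obj C \<Longrightarrow> y \<in> Obj C \<Longrightarrow> z \<in> Obj C \<Longrightarrow>
        Associator C w x (y \<otimes> z) \<cdot> Associator C (w \<otimes> x) y z =
        (\<I> w \<boxtimes> Associator C x y z) \<cdot> Associator C w (x \<otimes> y) z \<cdot> (Associator C w x y \<boxtimes> \<I> z)"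
    and triangle:
      "x \<in> Obj C \<Longrightarrow> y \<in> Obj C \<Longrightarrow>
        (\<I> x \<boxtimes> Left_unitor C y) \<cdot> Associator C x \<one> y = Right_unitor C x \<boxtimes> \<I> y"

record ('o, 'm) symmetric_monoidal_category = "('o, 'm) monoidal_category" +
  Braiding :: "'o \<Rightarrow> 'o \<Rightarrow> 'm"

locale symmetric_monoidal_category = monoidal_category C
  for C :: "('o, 'm, 'e) symmetric_monoidal_category_scheme" (structure) +
  assumes Braiding_in_Hom: "x \<in> Obj C \<Longrightarrow> y \<in> Obj C \<Longrightarrow> Braiding C x y \<in> Hom C (x \<otimes> y) (y \<otimes> x)"
    and Braiding_natural: "f \<in> Hom C x x' \<Longrightarrow> g \<in> Hom C y y' \<Longrightarrow>
      Braiding C x' y' \<cdot> (f \<boxtimes> g) = (g \<boxtimes> f) \<cdot> Braiding C x y"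
    and Braiding_symmetric: "x \<in> Obj C \<Longrightarrow> y \<in> Obj C \<Longrightarrow>
      Braiding C y x \<cdot> Braiding C x y = \<I> (x \<otimes> y)"
    and hexagon:
      "x \<in> Obj C \<Longrightarrow> y \<in> Obj C \<Longrightarrow> z \<in> Obj C \<Longrightarrow>
        Associator C y z x \<cdot> Braiding C x (y \<otimes> z) \<cdot> Associator C x y z =
        (\<I> y \<boxtimes> Braiding C x z) \<cdot> Associator C y x z \<cdot> (Braiding C x y \<boxtimes> \<I> z)"

text \<open>
  \<open>[y; z]\<close> is the internal hom and \<open>Curry C y x z\<close> the bijection from \<open>Hom (y \<otimes> x) z\<close> to
  \<open>Hom x [y; z]\<close>. The action of the internal hom on arrows is not part of the data: it is the
  unique one for which the bijection is natural in \<open>y\<close> and \<open>z\<close>, and it exists by naturality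
  in \<open>x\<close>.
\<close>

record ('o, 'm) closed_symmetric_monoidal_category = "('o, 'm) symmetric_monoidal_category" +
  Ihom :: "'o \<Rightarrow> 'o \<Rightarrow> 'o"  (\<open>[_; _]\<index>\<close>)
  Curry :: "'o \<Rightarrow> 'o \<Rightarrow> 'o \<Rightarrow> 'm \<Rightarrow> 'm"

locale closed_symmetric_monoidal_category = symmetric_monoidal_category C
  for C :: "('o, 'm, 'e) closed_symmetric_monoidal_category_scheme" (structure) +
  assumes Ihom_closed: "y \<in> Obj C \<Longrightarrow> z \<in> Obj C \<Longrightarrow> [y; z] \<in> Obj C"
    and Curry_bij: "x \<in> Obj C \<Longrightarrow> y \<in> Obj C \<Longrightarrow> z \<in> Obj C \<Longrightarrow>
      bij_betw (Curry C y x z) (Hom C (y \<otimes> x) z) (Hom C x [y; z])"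
    and Curry_natural: "y \<in> Obj C \<Longrightarrow> f \<in> Hom C (y \<otimes> x) z \<Longrightarrow> g \<in> Hom C x' x \<Longrightarrow>
      Curry C y x' z (f \<cdot> (\<I> y \<boxtimes> g)) = Curry C y x z f \<cdot> g"

definition Uncurry ::
    "('o, 'm, 'e) closed_symmetric_monoidal_category_scheme \<Rightarrow> 'o \<Rightarrow> 'o \<Rightarrow> 'o \<Rightarrow> 'm \<Rightarrow> 'm" where
  "Uncurry C y x z = the_inv_into (Hom C (Tensor C y x) z) (Curry C y x z)"

definition Eval ::
    "('o, 'm, 'e) closed_symmetric_monoidal_category_scheme \<Rightarrow> 'o \<Rightarrow> 'o \<Rightarrow> 'm" where
  "Eval C y z = Uncurry C y (Ihom C y z) z (Ident C (Ihom C y z))"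


section \<open>Left actions and the shift\<close>

text \<open>
  \<open>T\<close> with \<open>\<mu> : T \<otimes> T \<rightarrow> T\<close> and \<open>\<iota> : \<one> \<rightarrow> T\<close> is meant to be a monoid object.
\<close>

definition left_action ::
    "('o, 'm, 'e) monoidal_category_scheme \<Rightarrow> 'o \<Rightarrow> 'm \<Rightarrow> 'm \<Rightarrow> 'o \<Rightarrow> 'm \<Rightarrow> bool"
  where
  "left_action C T \<mu> \<iota> X \<Psi> \<longleftrightarrow>
     X \<in> Obj C \<and>
     \<Psi> \<in> Hom C (T \<otimes>\<^bsub>C\<^esub> X) X \<and>
     \<Psi> \<cdot>\<^bsub>C\<^esub> (\<iota> \<boxtimes>\<^bsub>C\<^esub> \<I>\<^bsub>C\<^esub> X) = Left_unitor C X \<and>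
     \<Psi> \<cdot>\<^bsub>C\<^esub> (\<I>\<^bsub>C\<^esub> T \<boxtimes>\<^bsub>C\<^esub> \<Psi>) \<cdot>\<^bsub>C\<^esub> Associator C T T X = \<Psi> \<cdot>\<^bsub>C\<^esub> (\<mu> \<boxtimes>\<^bsub>C\<^esub> \<I>\<^bsub>C\<^esub> X)"

definition shift ::
    "('o, 'm, 'e) closed_symmetric_monoidal_category_scheme \<Rightarrow> 'o \<Rightarrow> 'm \<Rightarrow> 'o \<Rightarrow> 'm" where
  "shift C T \<mu> \<Omega> =
     Curry C T (T \<otimes>\<^bsub>C\<^esub> [T; \<Omega>]\<^bsub>C\<^esub>) \<Omega>
       (Eval C T \<Omega> \<cdot>\<^bsub>C\<^esub> (\<mu> \<boxtimes>\<^bsub>C\<^esub> \<I>\<^bsub>C\<^esub> [T; \<Omega>]\<^bsub>C\<^esub>) \<cdot>\<^bsub>C\<^esub> inv_arr C (Associator C T T [T; \<Omega>]\<^bsub>C\<^esub>))"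


section \<open>Enriched categories and functors\<close>

text \<open>
  \<open>EComp A a b c : EHom A b c \<otimes> EHom A a b \<rightarrow> EHom A a c\<close> is composition in the usual order, and
  \<open>EId A a : \<one> \<rightarrow> EHom A a a\<close>.
\<close>

record ('a, 'o, 'm) enriched_category =
  EObj :: "'a set"
  EHom :: "'a \<Rightarrow> 'a \<Rightarrow> 'o"
  EComp :: "'a \<Rightarrow> 'a \<Rightarrow> 'a \<Rightarrow> 'm"
  EId :: "'a \<Rightarrow> 'm"

locale enriched_category = monoidal_category C
  for C :: "('o, 'm, 'e) monoidal_category_scheme" (structure)
    and A :: "('a, 'o, 'm) enriched_category" +
  assumes EHom_closed: "a \<in> EObj A \<Longrightarrow> b \<in> EObj A \<Longrightarrow> EHom A a b \<in> Obj C"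
    and EComp_in_Hom: "a \<in> EObj A \<Longrightarrow> b \<in> EObj A \<Longrightarrow> c \<in> EObj A \<Longrightarrow>
      EComp A a b c \<in> Hom C (EHom A b c \<otimes> EHom A a b) (EHom A a c)"
    and EId_in_Hom: "a \<in> EObj A \<Longrightarrow> EId A a \<in> Hom C \<one> (EHom A a a)"
    and EComp_assoc:
      "a \<in> EObj A \<Longrightarrow> b \<in> EObj A \<Longrightarrow> c \<in> EObj A \<Longrightarrow> d \<in> EObj A \<Longrightarrow>
        EComp A a b d \<cdot> (EComp A b c d \<boxtimes> \<I> (EHom A a b)) =
        EComp A a c d \<cdot> (\<I> (EHom A c d) \<boxtimes> EComp A a b c)
          \<cdot> Associator C (EHom A c d) (EHom A b c) (EHom A a b)"
    and EComp_EId_left: "a \<in> EObj A \<Longrightarrow> b \<in> EObj A \<Longrightarrow>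
      EComp A a b b \<cdot> (EId A b \<boxtimes> \<I> (EHom A a b)) = Left_unitor C (EHom A a b)"
    and EComp_EId_right: "a \<in> EObj A \<Longrightarrow> b \<in> EObj A \<Longrightarrow>
      EComp A a a b \<cdot> (\<I> (EHom A a b) \<boxtimes> EId A a) = Right_unitor C (EHom A a b)"

text \<open>
  The composition \<open>[y; z] \<otimes> [x; y] \<rightarrow> [x; z]\<close> of the self-enrichment is adjoint to
  \<open>x \<otimes> ([y; z] \<otimes> [x; y]) \<cong> (x \<otimes> [x; y]) \<otimes> [y; z] \<rightarrow> y \<otimes> [y; z] \<rightarrow> z\<close>. The braiding is needed
  because evaluation has its argument on the left.
\<close>

definition self_enrichment ::
    "('o, 'm, 'e) closed_symmetric_monoidal_category_scheme \<Rightarrow> ('o, 'o, 'm) enriched_category"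
  where
  "self_enrichment C =
     \<lparr>EObj = Obj C,
      EHom = Ihom C,
      EComp = (\<lambda>x y z.
        Curry C x ([y; z]\<^bsub>C\<^esub> \<otimes>\<^bsub>C\<^esub> [x; y]\<^bsub>C\<^esub>) z
          (Eval C y z
            \<cdot>\<^bsub>C\<^esub> (Eval C x y \<boxtimes>\<^bsub>C\<^esub> \<I>\<^bsub>C\<^esub> [y; z]\<^bsub>C\<^esub>)
            \<cdot>\<^bsub>C\<^esub> inv_arr C (Associator C x [x; y]\<^bsub>C\<^esub> [y; z]\<^bsub>C\<^esub>)
            \<cdot>\<^bsub>C\<^esub> (\<I>\<^bsub>C\<^esub> x \<boxtimes>\<^bsub>C\<^esub> Braiding C [y; z]\<^bsub>C\<^esub> [x; y]\<^bsub>C\<^esub>))),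
      EId = (\<lambda>x. Curry C x \<one>\<^bsub>C\<^esub> x (Right_unitor C x))\<rparr>"

text \<open>
  An enriched functor is required to be undefined outside the objects of its source, so that
  equality of functors is equality in HOL.
\<close>

record ('a, 'b, 'm) enriched_functor =
  FObj :: "'a \<Rightarrow> 'b"
  FHom :: "'a \<Rightarrow> 'a \<Rightarrow> 'm"

definition enriched_functor ::
    "('o, 'm, 'e) monoidal_category_scheme \<Rightarrow> ('a, 'o, 'm) enriched_category \<Rightarrow>
      ('b, 'o, 'm) enriched_category \<Rightarrow> ('a, 'b, 'm) enriched_functor \<Rightarrow> bool" where
  "enriched_functor C A B F \<longleftrightarrow>
     FObj F \<in> EObj A \<rightarrow>\<^sub>E EObj B \<and>
     (\<forall>a b. a \<notin> EObj A \<or> b \<notin> EObj A \<longrightarrow> FHom F a b = undefined) \<and>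
     (\<forall>a\<in>EObj A. \<forall>b\<in>EObj A. FHom F a b \<in> Hom C (EHom A a b) (EHom B (FObj F a) (FObj F b))) \<and>
     (\<forall>a\<in>EObj A. FHom F a a \<cdot>\<^bsub>C\<^esub> EId A a = EId B (FObj F a)) \<and>
     (\<forall>a\<in>EObj A. \<forall>b\<in>EObj A. \<forall>c\<in>EObj A.
        FHom F a c \<cdot>\<^bsub>C\<^esub> EComp A a b c =
        EComp B (FObj F a) (FObj F b) (FObj F c) \<cdot>\<^bsub>C\<^esub> (FHom F b c \<boxtimes>\<^bsub>C\<^esub> FHom F a b))"

text \<open>
  The arrow \<open>T \<otimes> X \<rightarrow> X\<close> adjoint to \<open>\<Psi> : T \<rightarrow> [X; X]\<close>. As the adjunction produces
  \<open>X \<otimes> T \<rightarrow> X\<close>, the factors have to be exchanged by the braiding.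
\<close>

definition adjoint_action ::
    "('o, 'm, 'e) closed_symmetric_monoidal_category_scheme \<Rightarrow> 'o \<Rightarrow> 'o \<Rightarrow> 'm \<Rightarrow> 'm" where
  "adjoint_action C T X \<Psi> = Uncurry C X T X \<Psi> \<cdot>\<^bsub>C\<^esub> Braiding C T X"

end

theory Submission
  imports Defs
begin

text \<open>
  In elements, the shift sends \<open>(t, p)\<close> to the path \<open>u \<mapsto> p (\<mu> (u, t))\<close>, that is,
  \<open>Eval \<cdot> (\<I> T \<boxtimes> shift) = Eval \<cdot> (\<mu> \<boxtimes> \<I> [T; \<Omega>])\<close> up to the associator (\<open>Eval_shift\<close>). Arrows into
  an internal hom are equal as soon as they agree after evaluation (\<open>Eval_eqI\<close>). Under evaluation
  the unit law of the shift becomes the right unit law of \<open>\<mu>\<close>, and its associativity law becomes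
  the associativity of \<open>\<mu>\<close>; the monoidal structure is not strict, so the triangle and the
  pentagon enter to compare the bracketings (\<open>left_action_shift\<close>).

  The second part holds for any left action \<open>\<Psi>\<close> of \<open>T\<close> on an object \<open>X\<close>. An enriched functor on a
  category with one object is given by its value \<open>X\<close> and one arrow \<open>T \<rightarrow> [X; X]\<close>. Currying and the
  invertibility of the braiding make \<open>adjoint_action\<close> a bijection from such arrows to arrows
  \<open>T \<otimes> X \<rightarrow> X\<close>, which gives uniqueness and the only candidate. That the candidate is a functor
  follows from the laws of the action, by evaluating on \<open>X\<close>. As evaluation takes its argument on the
  left while the action has it on the right, two coherence facts on the braiding are needed:
  \<open>Left_unitor_Braiding\<close> for units and \<open>Braiding_reversal\<close> for composition.
\<close>

section \<open>Composition and isomorphisms\<close>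

context category
begin

lemma Hom_iff: "f \<in> Hom C x y \<longleftrightarrow> f \<in> Arr C \<and> Dom C f = x \<and> Cod C f = y"
  by (simp add: Hom_def)

lemma Ident_typing [simp]:
  assumes "x \<in> Obj C"
  shows "\<I> x \<in> Arr C" and "Dom C (\<I> x) = x" and "Cod C (\<I> x) = x"
  using Ident_in_Hom[OF assms] by (simp_all add: Hom_iff)

lemma Comp_typing [simp]:
  assumes "f \<in> Arr C" and "g \<in> Arr C" and "Dom C g = Cod C f"
  shows "g \<cdot> f \<in> Arr C" and "Dom C (g \<cdot> f) = Dom C f" and "Cod C (g \<cdot> f) = Cod C g"
  using Comp_in_Hom[of f "Dom C f" "Cod C f" g "Cod C g"] assms by (simp_all add: Hom_iff)

lemma Arr_Obj [simp]:
  assumes "f \<in> Arr C"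
  shows "Dom C f \<in> Obj C" and "Cod C f \<in> Obj C"
  using assms by (simp_all add: Dom_closed Cod_closed)

lemma Comp_Ident [simp]:
  assumes "f \<in> Arr C"
  shows "Cod C f = y \<Longrightarrow> \<I> y \<cdot> f = f" and "Dom C f = x \<Longrightarrow> f \<cdot> \<I> x = f"
  using assms Comp_Ident_left[of f "Dom C f" y] Comp_Ident_right[of f x "Cod C f"]
  by (simp_all add: Hom_iff)

lemma Comp_assoc_Arr [simp]:
  assumes "f \<in> Arr C" and "g \<in> Arr C" and "h \<in> Arr C"
    and "Dom C g = Cod C f" and "Dom C h = Cod C g"
  shows "(h \<cdot> g) \<cdot> f = h \<cdot> g \<cdot> f"
  using assms by (auto intro: Comp_assoc simp: Hom_iff)

text \<open>
  Composites are kept associated to the right, so an equation between composites is applied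
  inside a longer composite through the following form of it.
\<close>

lemma Comp_reduce:
  assumes "g \<cdot> f = k" and "f \<in> Arr C" and "g \<in> Arr C" and "h \<in> Arr C"
    and "Dom C g = Cod C f" and "Dom C f = Cod C h"
  shows "g \<cdot> f \<cdot> h = k \<cdot> h"
  using assms by (simp flip: assms(1))

lemma inverse_arrows_inv_arr:
  assumes "iso_arr C f"
  shows "inverse_arrows C f (inv_arr C f)"
proof -
  obtain g where g: "inverse_arrows C f g"
    using assms by (auto simp: iso_arr_def)
  have "h = g" if h: "inverse_arrows C f h" for h
    using Comp_assoc_Arr[of g f h] g h
    by (simp add: inverse_arrows_def Hom_iff del: Comp_assoc_Arr)
  then show ?thesis
    unfolding inv_arr_def using g by (rule theI[rotated])
qed

lemma inv_arr_simps [simp]: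
  assumes "iso_arr C f"
  shows "inv_arr C f \<in> Arr C" and "Dom C (inv_arr C f) = Cod C f"
    and "Cod C (inv_arr C f) = Dom C f"
    and "f \<cdot> inv_arr C f = \<I> (Cod C f)" and "inv_arr C f \<cdot> f = \<I> (Dom C f)"
  using inverse_arrows_inv_arr[OF assms] by (simp_all add: inverse_arrows_def Hom_iff)

lemma iso_arr_cancel_right:
  assumes "iso_arr C f" and "f \<in> Arr C" and "g \<in> Arr C" and "h \<in> Arr C"
    and "Dom C g = Cod C f" and "Dom C h = Cod C f"
    and "g \<cdot> f = h \<cdot> f"
  shows "g = h"
proof -
  have "g = (g \<cdot> f) \<cdot> inv_arr C f"
    using assms(1-6) by simp
  also have "\<dots> = h"
    unfolding assms(7) using assms(1-6) by simp
  finally show ?thesis .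
qed

lemma iso_arr_cancel_left:
  assumes "iso_arr C f" and "f \<in> Arr C" and "g \<in> Arr C" and "h \<in> Arr C"
    and "Cod C g = Dom C f" and "Cod C h = Dom C f"
    and "f \<cdot> g = f \<cdot> h"
  shows "g = h"
  using Comp_assoc_Arr[of g f "inv_arr C f"] Comp_assoc_Arr[of h f "inv_arr C f"] assms
  by (simp del: Comp_assoc_Arr)

end

section \<open>Coherence in monoidal categories\<close>

context monoidal_category
begin

declare Unit_closed [simp] Tensor_closed [simp] Tensor_Ident [simp]
  Associator_iso [simp] Left_unitor_iso [simp] Right_unitor_iso [simp]

lemma Tensor_arr_typing [simp]:
  assumes "f \<in> Arr C" and "g \<in> Arr C"
  shows "f \<boxtimes> g \<in> Arr C" and "Dom C (f \<boxtimes> g) = Dom C f \<otimes> Dom C g"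
    and "Cod C (f \<boxtimes> g) = Cod C f \<otimes> Cod C g"
  using Tensor_arr_in_Hom[of f "Dom C f" "Cod C f" g "Dom C g" "Cod C g"] assms
  by (simp_all add: Hom_iff)

lemma Associator_typing [simp]:
  assumes "x \<in> Obj C" and "y \<in> Obj C" and "z \<in> Obj C"
  shows "Associator C x y z \<in> Arr C" and "Dom C (Associator C x y z) = (x \<otimes> y) \<otimes> z"
    and "Cod C (Associator C x y z) = x \<otimes> y \<otimes> z"
  using Associator_in_Hom[OF assms] by (simp_all add: Hom_iff)

lemma unitor_typing [simp]:
  assumes "x \<in> Obj C"
  shows "Left_unitor C x \<in> Arr C" and "Dom C (Left_unitor C x) = \<one> \<otimes> x"
    and "Cod C (Left_unitor C x) = x"
    and "Right_unitor C x \<in> Arr C" and "Dom C (Right_unitor C x) = x \<otimes> \<one>"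
    and "Cod C (Right_unitor C x) = x"
  using Left_unitor_in_Hom[OF assms] Right_unitor_in_Hom[OF assms] by (simp_all add: Hom_iff)

lemma interchange:
  assumes "f \<in> Arr C" and "f' \<in> Arr C" and "g \<in> Arr C" and "g' \<in> Arr C"
    and "Dom C f' = Cod C f" and "Dom C g' = Cod C g"
  shows "(f' \<boxtimes> g') \<cdot> (f \<boxtimes> g) = (f' \<cdot> f) \<boxtimes> (g' \<cdot> g)"
  using assms by (auto intro!: Tensor_Comp[symmetric] simp: Hom_iff)

lemma interchange_reduce:
  assumes "f \<in> Arr C" and "f' \<in> Arr C" and "g \<in> Arr C" and "g' \<in> Arr C" and "h \<in> Arr C"
    and "Dom C f' = Cod C f" and "Dom C g' = Cod C g" and "Cod C h = Dom C f \<otimes> Dom C g"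
  shows "(f' \<boxtimes> g') \<cdot> (f \<boxtimes> g) \<cdot> h = ((f' \<cdot> f) \<boxtimes> (g' \<cdot> g)) \<cdot> h"
  using assms by (intro Comp_reduce interchange) simp_all

lemma Associator_natural_Arr:
  assumes "f \<in> Arr C" and "g \<in> Arr C" and "h \<in> Arr C"
    and "Cod C f = x'" and "Cod C g = y'" and "Cod C h = z'"
  shows "Associator C x' y' z' \<cdot> ((f \<boxtimes> g) \<boxtimes> h)
    = (f \<boxtimes> (g \<boxtimes> h)) \<cdot> Associator C (Dom C f) (Dom C g) (Dom C h)"
  using assms by (auto intro: Associator_natural simp: Hom_iff)

lemma iso_arr_Tensor_Ident:
  assumes f: "f \<in> Arr C" "iso_arr C f" and x: "x \<in> Obj C"
  shows "iso_arr C (f \<boxtimes> \<I> x)"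
  unfolding iso_arr_def inverse_arrows_def
  using f x by (intro exI[of _ "inv_arr C f \<boxtimes> \<I> x"]) (simp add: Hom_iff interchange)

text \<open>
  Tensoring with the unit object is faithful, as the unitors identify it naturally with the
  identity functor.
\<close>

lemma Unit_Tensor_faithful:
  assumes "f \<in> Hom C x y" and "g \<in> Hom C x y" and "\<I> \<one> \<boxtimes> f = \<I> \<one> \<boxtimes> g"
  shows "f = g"
proof (rule iso_arr_cancel_right)
  show "f \<cdot> Left_unitor C x = g \<cdot> Left_unitor C x"
    using assms by (simp flip: Left_unitor_natural)
  show "iso_arr C (Left_unitor C x)"
    using assms by (auto simp: Hom_iff)
qed (use assms in \<open>auto simp: Hom_iff\<close>)

lemma Tensor_Unit_faithful:
  assumes "f \<in> Hom C x y" and "g \<in> Hom C x y" and "f \<boxtimes> \<I> \<one> = g \<boxtimes> \<I> \<one>"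
  shows "f = g"
proof (rule iso_arr_cancel_right)
  show "f \<cdot> Right_unitor C x = g \<cdot> Right_unitor C x"
    using assms by (simp flip: Right_unitor_natural)
  show "iso_arr C (Right_unitor C x)"
    using assms by (auto simp: Hom_iff)
qed (use assms in \<open>auto simp: Hom_iff\<close>)

text \<open>
  The triangle with the unit object in the leftmost position, which Kelly derived from the pentagon
  and the triangle with the unit object in the middle. Tensored with \<open>\<one>\<close> on the left, both sides
  are reached from the pentagon at \<open>\<one>, \<one>, x, y\<close>.
\<close>

lemma Left_unitor_Tensor:
  assumes x [simp]: "x \<in> Obj C" and y [simp]: "y \<in> Obj C"
  shows "Left_unitor C (x \<otimes> y) \<cdot> Associator C \<one> x y = Left_unitor C x \<boxtimes> \<I> y"
proof (rule Unit_Tensor_faithful)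
  let ?a = "Associator C" and ?l = "Left_unitor C" and ?r = "Right_unitor C"
  show "\<I> \<one> \<boxtimes> (?l (x \<otimes> y) \<cdot> ?a \<one> x y) = \<I> \<one> \<boxtimes> (?l x \<boxtimes> \<I> y)"
  proof (rule iso_arr_cancel_right[OF _ _ _ _ _ _ iso_arr_cancel_right])
    have "((\<I> \<one> \<boxtimes> (?l (x \<otimes> y) \<cdot> ?a \<one> x y)) \<cdot> ?a \<one> (\<one> \<otimes> x) y) \<cdot> (?a \<one> \<one> x \<boxtimes> \<I> y)
        = (\<I> \<one> \<boxtimes> ?l (x \<otimes> y)) \<cdot> (\<I> \<one> \<boxtimes> ?a \<one> x y) \<cdot> ?a \<one> (\<one> \<otimes> x) y \<cdot> (?a \<one> \<one> x \<boxtimes> \<I> y)"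
      by (simp add: interchange_reduce)
    also have "\<dots> = (\<I> \<one> \<boxtimes> ?l (x \<otimes> y)) \<cdot> ?a \<one> \<one> (x \<otimes> y) \<cdot> ?a (\<one> \<otimes> \<one>) x y"
      by (simp add: pentagon)
    also have "\<dots> = (?r \<one> \<boxtimes> \<I> (x \<otimes> y)) \<cdot> ?a (\<one> \<otimes> \<one>) x y"
      by (rule Comp_reduce[OF triangle]) simp_all
    also have "\<dots> = ?a \<one> x y \<cdot> ((?r \<one> \<boxtimes> \<I> x) \<boxtimes> \<I> y)"
      by (simp add: Associator_natural_Arr)
    also have "\<dots> = ?a \<one> x y \<cdot> ((\<I> \<one> \<boxtimes> ?l x) \<boxtimes> \<I> y) \<cdot> (?a \<one> \<one> x \<boxtimes> \<I> y)"
      by (simp add: interchange triangle)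
    also have "\<dots> = ((\<I> \<one> \<boxtimes> (?l x \<boxtimes> \<I> y)) \<cdot> ?a \<one> (\<one> \<otimes> x) y) \<cdot> (?a \<one> \<one> x \<boxtimes> \<I> y)"
      by (simp add: Comp_reduce[OF Associator_natural_Arr])
    finally show "((\<I> \<one> \<boxtimes> (?l (x \<otimes> y) \<cdot> ?a \<one> x y)) \<cdot> ?a \<one> (\<one> \<otimes> x) y) \<cdot> (?a \<one> \<one> x \<boxtimes> \<I> y)
        = ((\<I> \<one> \<boxtimes> (?l x \<boxtimes> \<I> y)) \<cdot> ?a \<one> (\<one> \<otimes> x) y) \<cdot> (?a \<one> \<one> x \<boxtimes> \<I> y)" .
  qed (simp_all add: iso_arr_Tensor_Ident)
qed (simp_all add: Hom_iff)

end

section \<open>Coherence in symmetric monoidal categories\<close>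

context symmetric_monoidal_category
begin

lemma Braiding_typing [simp]:
  assumes "x \<in> Obj C" and "y \<in> Obj C"
  shows "Braiding C x y \<in> Arr C" and "Dom C (Braiding C x y) = x \<otimes> y"
    and "Cod C (Braiding C x y) = y \<otimes> x"
  using Braiding_in_Hom[OF assms] by (simp_all add: Hom_iff)

declare Braiding_symmetric [simp]

lemma Braiding_natural_Arr:
  assumes "f \<in> Arr C" and "g \<in> Arr C" and "Cod C f = x'" and "Cod C g = y'"
  shows "Braiding C x' y' \<cdot> (f \<boxtimes> g) = (g \<boxtimes> f) \<cdot> Braiding C (Dom C f) (Dom C g)"
  using assms by (auto intro: Braiding_natural simp: Hom_iff)

lemma iso_arr_Braiding [simp]:
  assumes "x \<in> Obj C" and "y \<in> Obj C"
  shows "iso_arr C (Braiding C x y)"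
  unfolding iso_arr_def inverse_arrows_def
  using assms by (intro exI[of _ "Braiding C y x"]) (simp add: Hom_iff)

text \<open>
  The hexagon at \<open>x, \<one>, \<one>\<close> yields this after tensoring with \<open>\<one>\<close> on the right and composing with the
  braiding.
\<close>

lemma Left_unitor_Braiding:
  assumes x [simp]: "x \<in> Obj C"
  shows "Left_unitor C x \<cdot> Braiding C x \<one> = Right_unitor C x"
proof (rule Tensor_Unit_faithful)
  let ?a = "Associator C" and ?l = "Left_unitor C" and ?r = "Right_unitor C"
    and ?B = "Braiding C"
  show "(?l x \<cdot> ?B x \<one>) \<boxtimes> \<I> \<one> = ?r x \<boxtimes> \<I> \<one>"
  proof (rule iso_arr_cancel_left)
    have "?B x \<one> \<cdot> ((?l x \<cdot> ?B x \<one>) \<boxtimes> \<I> \<one>) = ?B x \<one> \<cdot> (?l x \<boxtimes> \<I> \<one>) \<cdot> (?B x \<one> \<boxtimes> \<I> \<one>)"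
      by (simp add: interchange)
    also have "\<dots> = ?B x \<one> \<cdot> ?l (x \<otimes> \<one>) \<cdot> ?a \<one> x \<one> \<cdot> (?B x \<one> \<boxtimes> \<I> \<one>)"
      by (simp flip: Left_unitor_Tensor)
    also have "\<dots> = ?l (\<one> \<otimes> x) \<cdot> (\<I> \<one> \<boxtimes> ?B x \<one>) \<cdot> ?a \<one> x \<one> \<cdot> (?B x \<one> \<boxtimes> \<I> \<one>)"
      by (simp add: Comp_reduce[OF Left_unitor_natural[OF Braiding_in_Hom]])
    also have "\<dots> = ?l (\<one> \<otimes> x) \<cdot> ?a \<one> \<one> x \<cdot> ?B x (\<one> \<otimes> \<one>) \<cdot> ?a x \<one> \<one>"
      by (simp flip: hexagon)
    also have "\<dots> = (?l \<one> \<boxtimes> \<I> x) \<cdot> ?B x (\<one> \<otimes> \<one>) \<cdot> ?a x \<one> \<one>"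
      by (rule Comp_reduce[OF Left_unitor_Tensor]) simp_all
    also have "\<dots> = ?B x \<one> \<cdot> (\<I> x \<boxtimes> ?l \<one>) \<cdot> ?a x \<one> \<one>"
      by (simp add: Comp_reduce[OF Braiding_natural_Arr])
    also have "\<dots> = ?B x \<one> \<cdot> (?r x \<boxtimes> \<I> \<one>)"
      by (simp add: triangle)
    finally show "?B x \<one> \<cdot> ((?l x \<cdot> ?B x \<one>) \<boxtimes> \<I> \<one>) = ?B x \<one> \<cdot> (?r x \<boxtimes> \<I> \<one>)" .
  qed simp_all
qed (simp_all add: Hom_iff)

text \<open>
  Two ways of reversing the order of three factors agree (the Yang-Baxter equation, with one pair of
  exchanges on each side merged into a single braiding). The hexagon is used twice, at \<open>a, b, x\<close> and
  at \<open>x, b, a\<close>; symmetry of the braiding links the two instances.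
\<close>

lemma Braiding_reversal:
  assumes x [simp]: "x \<in> Obj C" and b [simp]: "b \<in> Obj C" and a [simp]: "a \<in> Obj C"
  shows "Braiding C (b \<otimes> x) a \<cdot> (Braiding C x b \<boxtimes> \<I> a)
    = Associator C a b x \<cdot> (Braiding C b a \<boxtimes> \<I> x) \<cdot> Braiding C x (b \<otimes> a) \<cdot> Associator C x b a"
    (is "_ = ?R")
proof -
  let ?a = "Associator C" and ?B = "Braiding C"
  \<comment> \<open>It suffices to undo the braiding \<open>B (b \<otimes> x) a\<close>, whose inverse is the braiding in the hexagon.\<close>
  have "?B a (b \<otimes> x) \<cdot> ?R = ?B x b \<boxtimes> \<I> a"
  proof (rule iso_arr_cancel_left)
    have "?a b x a \<cdot> ?B a (b \<otimes> x) \<cdot> ?R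
        = (?a b x a \<cdot> ?B a (b \<otimes> x) \<cdot> ?a a b x) \<cdot> (?B b a \<boxtimes> \<I> x) \<cdot> ?B x (b \<otimes> a) \<cdot> ?a x b a"
      by simp
    also have "\<dots> = (\<I> b \<boxtimes> ?B a x) \<cdot> ?a b a x \<cdot> (?B a b \<boxtimes> \<I> x) \<cdot> (?B b a \<boxtimes> \<I> x)
        \<cdot> ?B x (b \<otimes> a) \<cdot> ?a x b a"
      by (subst hexagon) simp_all
    also have "\<dots> = (\<I> b \<boxtimes> ?B a x) \<cdot> ?a b a x \<cdot> ?B x (b \<otimes> a) \<cdot> ?a x b a"
      by (simp add: interchange_reduce)
    also have "\<dots> = (\<I> b \<boxtimes> ?B a x) \<cdot> (\<I> b \<boxtimes> ?B x a) \<cdot> ?a b x a \<cdot> (?B x b \<boxtimes> \<I> a)"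
      by (simp add: hexagon)
    also have "\<dots> = ?a b x a \<cdot> (?B x b \<boxtimes> \<I> a)"
      by (simp add: interchange_reduce)
    finally show "?a b x a \<cdot> ?B a (b \<otimes> x) \<cdot> ?R = ?a b x a \<cdot> (?B x b \<boxtimes> \<I> a)" .
  qed simp_all
  then have "?B (b \<otimes> x) a \<cdot> (?B x b \<boxtimes> \<I> a) = ?B (b \<otimes> x) a \<cdot> ?B a (b \<otimes> x) \<cdot> ?R"
    by simp
  also have "\<dots> = ?R"
    by (simp add: Comp_reduce[OF Braiding_symmetric])
  finally show ?thesis .
qed

end

section \<open>Currying and evaluation\<close>

context closed_symmetric_monoidal_category
begin

declare Ihom_closed [simp]

lemma Curry_typing [simp]:
  assumes "y \<in> Obj C" and "x \<in> Obj C" and "f \<in> Arr C" and "Dom C f = y \<otimes> x" and "Cod C f = z"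
  shows "Curry C y x z f \<in> Arr C" and "Dom C (Curry C y x z f) = x"
    and "Cod C (Curry C y x z f) = [y; z]"
  using bij_betw_apply[OF Curry_bij[of x y z], of f] assms by (auto simp: Hom_iff)

lemma Uncurry_in_Hom:
  assumes "y \<in> Obj C" and "x \<in> Obj C" and "z \<in> Obj C" and "f \<in> Hom C x [y; z]"
  shows "Uncurry C y x z f \<in> Hom C (y \<otimes> x) z"
  using bij_betw_apply[OF bij_betw_the_inv_into[OF Curry_bij]] assms
  by (simp add: Uncurry_def)

lemma Curry_Uncurry:
  assumes "y \<in> Obj C" and "x \<in> Obj C" and "z \<in> Obj C" and "f \<in> Hom C x [y; z]"
  shows "Curry C y x z (Uncurry C y x z f) = f"
  using f_the_inv_into_f_bij_betw[OF Curry_bij, of x y z f] assms by (simp add: Uncurry_def)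

lemma Uncurry_Curry:
  assumes "y \<in> Obj C" and "x \<in> Obj C" and "z \<in> Obj C" and "f \<in> Hom C (y \<otimes> x) z"
  shows "Uncurry C y x z (Curry C y x z f) = f"
  using the_inv_into_f_f[OF bij_betw_imp_inj_on[OF Curry_bij], of x y z f] assms
  by (simp add: Uncurry_def)

lemma Eval_typing [simp]:
  assumes "y \<in> Obj C" and "z \<in> Obj C"
  shows "Eval C y z \<in> Arr C" and "Dom C (Eval C y z) = y \<otimes> [y; z]"
    and "Cod C (Eval C y z) = z"
  using Uncurry_in_Hom[of y "[y; z]" z "\<I> [y; z]"] assms by (simp_all add: Eval_def Hom_iff)

lemma Uncurry_eq_Eval:
  assumes "y \<in> Obj C" and "z \<in> Obj C" and "f \<in> Hom C x [y; z]"
  shows "Uncurry C y x z f = Eval C y z \<cdot> (\<I> y \<boxtimes> f)"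
proof -
  have x: "x \<in> Obj C"
    using assms by (auto simp: Hom_iff)
  have "Curry C y x z (Eval C y z \<cdot> (\<I> y \<boxtimes> f)) = Curry C y [y; z] z (Eval C y z) \<cdot> f"
    using assms by (intro Curry_natural) (auto simp: Hom_iff)
  also have "\<dots> = f"
    using assms by (auto simp: Eval_def Curry_Uncurry Hom_iff)
  finally have "Curry C y x z (Eval C y z \<cdot> (\<I> y \<boxtimes> f)) = f" .
  then show ?thesis
    using Uncurry_Curry[of y x z "Eval C y z \<cdot> (\<I> y \<boxtimes> f)"] assms x by (auto simp: Hom_iff)
qed

lemma Eval_Curry:
  assumes "y \<in> Obj C" and "x \<in> Obj C" and "f \<in> Hom C (y \<otimes> x) z"
  shows "Eval C y z \<cdot> (\<I> y \<boxtimes> Curry C y x z f) = f"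
  using assms Uncurry_eq_Eval[of y z "Curry C y x z f" x] Uncurry_Curry[of y x z f]
  by (auto simp: Hom_iff)

lemma Eval_eqI:
  assumes "y \<in> Obj C" and "z \<in> Obj C" and "f \<in> Hom C x [y; z]" and "g \<in> Hom C x [y; z]"
    and "Eval C y z \<cdot> (\<I> y \<boxtimes> f) = Eval C y z \<cdot> (\<I> y \<boxtimes> g)"
  shows "f = g"
proof -
  have "x \<in> Obj C"
    using assms by (auto simp: Hom_iff)
  then show ?thesis
    using assms Curry_Uncurry[of y x z f] Curry_Uncurry[of y x z g]
    by (simp add: Uncurry_eq_Eval)
qed

lemma adjoint_action_Eval:
  assumes "T \<in> Obj C" and "X \<in> Obj C" and "F \<in> Hom C T [X; X]"
  shows "adjoint_action C T X F = Eval C X X \<cdot> (\<I> X \<boxtimes> F) \<cdot> Braiding C T X"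
  using assms unfolding adjoint_action_def by (auto simp: Uncurry_eq_Eval Hom_iff)

lemma adjoint_action_inj:
  assumes T [simp]: "T \<in> Obj C" and X [simp]: "X \<in> Obj C"
    and F: "F \<in> Hom C T [X; X]" and G: "G \<in> Hom C T [X; X]"
    and eq: "adjoint_action C T X F = adjoint_action C T X G"
  shows "F = G"
proof (rule Eval_eqI[OF X X F G])
  show "Eval C X X \<cdot> (\<I> X \<boxtimes> F) = Eval C X X \<cdot> (\<I> X \<boxtimes> G)"
  proof (rule iso_arr_cancel_right)
    show "(Eval C X X \<cdot> (\<I> X \<boxtimes> F)) \<cdot> Braiding C T X = (Eval C X X \<cdot> (\<I> X \<boxtimes> G)) \<cdot> Braiding C T X"
      using F G eq by (simp add: adjoint_action_Eval Hom_iff)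
  qed (use F G in \<open>simp_all add: Hom_iff\<close>)
qed

section \<open>The shift is a left action\<close>

text \<open>
  \<open>Eval_shift\<close> is the defining adjunction of the shift, with the inverse of the associator moved to
  the other side.
\<close>

lemma
  assumes T [simp]: "T \<in> Obj C" and \<Omega> [simp]: "\<Omega> \<in> Obj C" and \<mu>: "\<mu> \<in> Hom C (T \<otimes> T) T"
  shows shift_in_Hom: "shift C T \<mu> \<Omega> \<in> Hom C (T \<otimes> [T; \<Omega>]) [T; \<Omega>]"
    and Eval_shift: "Eval C T \<Omega> \<cdot> (\<I> T \<boxtimes> shift C T \<mu> \<Omega>) \<cdot> Associator C T T [T; \<Omega>]
      = Eval C T \<Omega> \<cdot> (\<mu> \<boxtimes> \<I> [T; \<Omega>])"
proof -
  let ?P = "[T; \<Omega>]" and ?ev = "Eval C T \<Omega>" and ?a = "Associator C T T [T; \<Omega>]"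
  let ?f = "?ev \<cdot> (\<mu> \<boxtimes> \<I> ?P) \<cdot> inv_arr C ?a"
  have [simp]: "\<mu> \<in> Arr C" "Dom C \<mu> = T \<otimes> T" "Cod C \<mu> = T"
    using \<mu> by (simp_all add: Hom_iff)
  show \<sigma>: "shift C T \<mu> \<Omega> \<in> Hom C (T \<otimes> ?P) ?P"
    by (simp add: shift_def Hom_iff)
  have "?ev \<cdot> (\<I> T \<boxtimes> shift C T \<mu> \<Omega>) \<cdot> ?a = (?ev \<cdot> (\<I> T \<boxtimes> shift C T \<mu> \<Omega>)) \<cdot> ?a"
    using \<sigma> by (simp add: Hom_iff)
  also have "\<dots> = ?f \<cdot> ?a"
    unfolding shift_def by (subst Eval_Curry) (simp_all add: Hom_iff)
  also have "\<dots> = ?ev \<cdot> (\<mu> \<boxtimes> \<I> ?P)"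
    by simp
  finally show "?ev \<cdot> (\<I> T \<boxtimes> shift C T \<mu> \<Omega>) \<cdot> ?a = ?ev \<cdot> (\<mu> \<boxtimes> \<I> ?P)" .
qed

lemma left_action_shift:
  assumes T [simp]: "T \<in> Obj C" and \<Omega> [simp]: "\<Omega> \<in> Obj C"
    and \<mu>: "\<mu> \<in> Hom C (T \<otimes> T) T" and \<iota>: "\<iota> \<in> Hom C \<one> T"
    and assoc: "\<mu> \<cdot> (\<mu> \<boxtimes> \<I> T) = \<mu> \<cdot> (\<I> T \<boxtimes> \<mu>) \<cdot> Associator C T T T"
    and unit: "\<mu> \<cdot> (\<I> T \<boxtimes> \<iota>) = Right_unitor C T"
  shows "left_action C T \<mu> \<iota> [T; \<Omega>] (shift C T \<mu> \<Omega>)"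
proof -
  let ?P = "[T; \<Omega>]" and ?ev = "Eval C T \<Omega>" and ?s = "shift C T \<mu> \<Omega>" and ?a = "Associator C"
  have \<sigma>: "?s \<in> Hom C (T \<otimes> ?P) ?P"
    using T \<Omega> \<mu> by (rule shift_in_Hom)
  have [simp]: "\<mu> \<in> Arr C" "Dom C \<mu> = T \<otimes> T" "Cod C \<mu> = T"
    "\<iota> \<in> Arr C" "Dom C \<iota> = \<one>" "Cod C \<iota> = T"
    "?s \<in> Arr C" "Dom C ?s = T \<otimes> ?P" "Cod C ?s = ?P"
    using \<mu> \<iota> \<sigma> by (simp_all add: Hom_iff)
  note Eval_s = Eval_shift[OF T \<Omega> \<mu>]
  have Eval_s_reduce: "?ev \<cdot> (\<I> T \<boxtimes> ?s) \<cdot> ?a T T ?P \<cdot> h = ?ev \<cdot> (\<mu> \<boxtimes> \<I> ?P) \<cdot> h"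
    if h: "h \<in> Arr C" "Cod C h = (T \<otimes> T) \<otimes> ?P" for h
  proof -
    have "(?ev \<cdot> (\<I> T \<boxtimes> ?s) \<cdot> ?a T T ?P) \<cdot> h = (?ev \<cdot> (\<mu> \<boxtimes> \<I> ?P)) \<cdot> h"
      unfolding Eval_s ..
    then show ?thesis
      using h by simp
  qed
  have "?s \<cdot> (\<iota> \<boxtimes> \<I> ?P) = Left_unitor C ?P"
  proof (rule Eval_eqI[OF T \<Omega>], goal_cases)
    case 3
    show ?case
    proof (rule iso_arr_cancel_right)
      have "(?ev \<cdot> (\<I> T \<boxtimes> (?s \<cdot> (\<iota> \<boxtimes> \<I> ?P)))) \<cdot> ?a T \<one> ?P
          = ?ev \<cdot> (\<I> T \<boxtimes> ?s) \<cdot> (\<I> T \<boxtimes> (\<iota> \<boxtimes> \<I> ?P)) \<cdot> ?a T \<one> ?P"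
        by (simp add: interchange_reduce)
      also have "\<dots> = ?ev \<cdot> (\<I> T \<boxtimes> ?s) \<cdot> ?a T T ?P \<cdot> ((\<I> T \<boxtimes> \<iota>) \<boxtimes> \<I> ?P)"
        by (simp add: Associator_natural_Arr)
      also have "\<dots> = ?ev \<cdot> (\<mu> \<boxtimes> \<I> ?P) \<cdot> ((\<I> T \<boxtimes> \<iota>) \<boxtimes> \<I> ?P)"
        by (simp add: Eval_s_reduce)
      also have "\<dots> = ?ev \<cdot> (Right_unitor C T \<boxtimes> \<I> ?P)"
        by (simp add: interchange unit)
      also have "\<dots> = (?ev \<cdot> (\<I> T \<boxtimes> Left_unitor C ?P)) \<cdot> ?a T \<one> ?P"
        by (simp add: triangle)
      finally show "(?ev \<cdot> (\<I> T \<boxtimes> (?s \<cdot> (\<iota> \<boxtimes> \<I> ?P)))) \<cdot> ?a T \<one> ?P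
          = (?ev \<cdot> (\<I> T \<boxtimes> Left_unitor C ?P)) \<cdot> ?a T \<one> ?P" .
    qed simp_all
  qed (simp_all add: Hom_iff)
  moreover have "?s \<cdot> (\<I> T \<boxtimes> ?s) \<cdot> ?a T T ?P = ?s \<cdot> (\<mu> \<boxtimes> \<I> ?P)" (is "?L = ?R")
  proof (rule Eval_eqI[OF T \<Omega>], goal_cases)
    case 3
    \<comment> \<open>\<open>?c \<cdot> ?d\<close> rebrackets \<open>((T \<otimes> T) \<otimes> T) \<otimes> P\<close>, so that the pentagon applies to the left-hand side.\<close>
    let ?c = "?a T (T \<otimes> T) ?P" and ?d = "?a T T T \<boxtimes> \<I> ?P"
    have "((?ev \<cdot> (\<I> T \<boxtimes> ?L)) \<cdot> ?c) \<cdot> ?d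
        = ?ev \<cdot> (\<I> T \<boxtimes> ?s) \<cdot> (\<I> T \<boxtimes> (\<I> T \<boxtimes> ?s)) \<cdot> (\<I> T \<boxtimes> ?a T T ?P) \<cdot> ?c \<cdot> ?d"
      by (simp add: interchange_reduce)
    also have "\<dots> = ?ev \<cdot> (\<I> T \<boxtimes> ?s) \<cdot> (\<I> T \<boxtimes> (\<I> T \<boxtimes> ?s)) \<cdot> ?a T T (T \<otimes> ?P) \<cdot> ?a (T \<otimes> T) T ?P"
      by (simp add: pentagon)
    also have "\<dots> = ?ev \<cdot> (\<I> T \<boxtimes> ?s) \<cdot> ?a T T ?P \<cdot> (\<I> (T \<otimes> T) \<boxtimes> ?s) \<cdot> ?a (T \<otimes> T) T ?P"
      by (simp add: Comp_reduce[OF Associator_natural_Arr] flip: Tensor_Ident)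
    also have "\<dots> = ?ev \<cdot> (\<mu> \<boxtimes> \<I> ?P) \<cdot> (\<I> (T \<otimes> T) \<boxtimes> ?s) \<cdot> ?a (T \<otimes> T) T ?P"
      by (simp add: Eval_s_reduce)
    also have "\<dots> = ?ev \<cdot> (\<I> T \<boxtimes> ?s) \<cdot> (\<mu> \<boxtimes> \<I> (T \<otimes> ?P)) \<cdot> ?a (T \<otimes> T) T ?P"
      by (simp add: interchange_reduce)
    also have "\<dots> = ?ev \<cdot> (\<I> T \<boxtimes> ?s) \<cdot> ?a T T ?P \<cdot> ((\<mu> \<boxtimes> \<I> T) \<boxtimes> \<I> ?P)"
      by (simp add: Associator_natural_Arr)
    also have "\<dots> = ?ev \<cdot> ((\<mu> \<cdot> (\<mu> \<boxtimes> \<I> T)) \<boxtimes> \<I> ?P)"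
      by (simp add: Eval_s_reduce interchange)
    also have "\<dots> = ?ev \<cdot> (\<mu> \<boxtimes> \<I> ?P) \<cdot> ((\<I> T \<boxtimes> \<mu>) \<boxtimes> \<I> ?P) \<cdot> ?d"
      by (simp add: assoc interchange)
    also have "\<dots> = ?ev \<cdot> (\<I> T \<boxtimes> ?s) \<cdot> ?a T T ?P \<cdot> ((\<I> T \<boxtimes> \<mu>) \<boxtimes> \<I> ?P) \<cdot> ?d"
      by (simp add: Eval_s_reduce)
    also have "\<dots> = ?ev \<cdot> (\<I> T \<boxtimes> ?s) \<cdot> (\<I> T \<boxtimes> (\<mu> \<boxtimes> \<I> ?P)) \<cdot> ?c \<cdot> ?d"
      by (simp add: Comp_reduce[OF Associator_natural_Arr])
    also have "\<dots> = ((?ev \<cdot> (\<I> T \<boxtimes> ?R)) \<cdot> ?c) \<cdot> ?d"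
      by (simp add: interchange_reduce)
    finally have "((?ev \<cdot> (\<I> T \<boxtimes> ?L)) \<cdot> ?c) \<cdot> ?d = ((?ev \<cdot> (\<I> T \<boxtimes> ?R)) \<cdot> ?c) \<cdot> ?d" .
    then show ?case
      by (rule iso_arr_cancel_right[OF _ _ _ _ _ _ iso_arr_cancel_right, rotated -1])
        (simp_all add: iso_arr_Tensor_Ident)
  qed (simp_all add: Hom_iff)
  ultimately show ?thesis
    using \<sigma> by (simp add: left_action_def)
qed

section \<open>Left actions as enriched functors\<close>

text \<open>
  The functor laws of an arrow \<open>F : T \<rightarrow> [X; X]\<close> follow from the action laws of its adjoint
  \<open>T \<otimes> X \<rightarrow> X\<close>, by comparing both sides of each functor law after evaluation.
\<close>

lemma
  assumes X [simp]: "X \<in> Obj C"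
    and F: "F \<in> Hom C T [X; X]" and \<mu>: "\<mu> \<in> Hom C (T \<otimes> T) T" and \<iota>: "\<iota> \<in> Hom C \<one> T"
    and act: "left_action C T \<mu> \<iota> X (adjoint_action C T X F)"
  shows left_action_imp_unit: "F \<cdot> \<iota> = EId (self_enrichment C) X"
    and left_action_imp_comp: "F \<cdot> \<mu> = EComp (self_enrichment C) X X X \<cdot> (F \<boxtimes> F)"
proof -
  let ?a = "Associator C" and ?B = "Braiding C" and ?ev = "Eval C X X" and ?H = "[X; X]"
  define \<Psi> where "\<Psi> = adjoint_action C T X F"
  have T [simp]: "T \<in> Obj C"
    using F by (auto simp: Hom_iff)
  have [simp]: "F \<in> Arr C" "Dom C F = T" "Cod C F = ?H"
    "\<mu> \<in> Arr C" "Dom C \<mu> = T \<otimes> T" "Cod C \<mu> = T" "\<iota> \<in> Arr C" "Dom C \<iota> = \<one>" "Cod C \<iota> = T"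
    "\<Psi> \<in> Arr C" "Dom C \<Psi> = T \<otimes> X" "Cod C \<Psi> = X"
    using F \<mu> \<iota> act by (simp_all add: Hom_iff left_action_def \<Psi>_def)
  have act_unit: "\<Psi> \<cdot> (\<iota> \<boxtimes> \<I> X) = Left_unitor C X"
    and act_comp: "\<Psi> \<cdot> (\<I> T \<boxtimes> \<Psi>) \<cdot> ?a T T X = \<Psi> \<cdot> (\<mu> \<boxtimes> \<I> X)"
    using act by (simp_all add: left_action_def \<Psi>_def)
  have ev_F: "?ev \<cdot> (\<I> X \<boxtimes> F) = \<Psi> \<cdot> ?B X T"
    using F by (simp add: \<Psi>_def adjoint_action_Eval)
  show "F \<cdot> \<iota> = EId (self_enrichment C) X"
  proof (rule Eval_eqI[OF X X], goal_cases)
    case 3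
    have "?ev \<cdot> (\<I> X \<boxtimes> (F \<cdot> \<iota>)) = ?ev \<cdot> (\<I> X \<boxtimes> F) \<cdot> (\<I> X \<boxtimes> \<iota>)"
      by (simp add: interchange)
    also have "\<dots> = \<Psi> \<cdot> ?B X T \<cdot> (\<I> X \<boxtimes> \<iota>)"
      by (simp add: Comp_reduce[OF ev_F])
    also have "\<dots> = \<Psi> \<cdot> (\<iota> \<boxtimes> \<I> X) \<cdot> ?B X \<one>"
      by (simp add: Braiding_natural_Arr)
    also have "\<dots> = Left_unitor C X \<cdot> ?B X \<one>"
      by (simp add: Comp_reduce[OF act_unit])
    also have "\<dots> = ?ev \<cdot> (\<I> X \<boxtimes> EId (self_enrichment C) X)"
      by (simp add: Left_unitor_Braiding self_enrichment_def Eval_Curry Hom_iff)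
    finally show ?case .
  qed (simp_all add: Hom_iff self_enrichment_def)
  define c where "c = EComp (self_enrichment C) X X X"
  have ev_c: "?ev \<cdot> (\<I> X \<boxtimes> c) = ?ev \<cdot> (?ev \<boxtimes> \<I> ?H) \<cdot> inv_arr C (?a X ?H ?H) \<cdot> (\<I> X \<boxtimes> ?B ?H ?H)"
    by (simp add: c_def self_enrichment_def Eval_Curry Hom_iff)
  have [simp]: "c \<in> Arr C" "Dom C c = ?H \<otimes> ?H" "Cod C c = ?H"
    by (simp_all add: c_def self_enrichment_def)
  have inv_natural: "inv_arr C (?a X ?H ?H) \<cdot> (\<I> X \<boxtimes> (F \<boxtimes> F))
      = ((\<I> X \<boxtimes> F) \<boxtimes> F) \<cdot> inv_arr C (?a X T T)"
  proof (rule iso_arr_cancel_left[of "?a X ?H ?H"])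
    have "?a X ?H ?H \<cdot> ((\<I> X \<boxtimes> F) \<boxtimes> F) \<cdot> inv_arr C (?a X T T)
        = (\<I> X \<boxtimes> (F \<boxtimes> F)) \<cdot> ?a X T T \<cdot> inv_arr C (?a X T T)"
      by (simp add: Comp_reduce[OF Associator_natural_Arr] del: inv_arr_simps(4))
    then show "?a X ?H ?H \<cdot> inv_arr C (?a X ?H ?H) \<cdot> (\<I> X \<boxtimes> (F \<boxtimes> F))
        = ?a X ?H ?H \<cdot> ((\<I> X \<boxtimes> F) \<boxtimes> F) \<cdot> inv_arr C (?a X T T)"
      by (simp add: Comp_reduce[OF inv_arr_simps(4)])
  qed simp_all
  show "F \<cdot> \<mu> = EComp (self_enrichment C) X X X \<cdot> (F \<boxtimes> F)"
    unfolding c_def[symmetric]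
  proof (rule Eval_eqI[OF X X], goal_cases)
    case 3
    have "?ev \<cdot> (\<I> X \<boxtimes> (c \<cdot> (F \<boxtimes> F))) = (?ev \<cdot> (\<I> X \<boxtimes> c)) \<cdot> (\<I> X \<boxtimes> (F \<boxtimes> F))"
      by (simp add: interchange)
    also have "\<dots> = ?ev \<cdot> (?ev \<boxtimes> \<I> ?H) \<cdot> inv_arr C (?a X ?H ?H) \<cdot> (\<I> X \<boxtimes> (?B ?H ?H \<cdot> (F \<boxtimes> F)))"
      unfolding ev_c by (simp add: interchange)
    also have "\<dots> = ?ev \<cdot> (?ev \<boxtimes> \<I> ?H) \<cdot> inv_arr C (?a X ?H ?H) \<cdot> (\<I> X \<boxtimes> (F \<boxtimes> F)) \<cdot> (\<I> X \<boxtimes> ?B T T)"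
      by (simp add: Braiding_natural_Arr interchange)
    also have "\<dots> = ?ev \<cdot> (?ev \<boxtimes> \<I> ?H) \<cdot> ((\<I> X \<boxtimes> F) \<boxtimes> F) \<cdot> inv_arr C (?a X T T) \<cdot> (\<I> X \<boxtimes> ?B T T)"
      by (simp add: Comp_reduce[OF inv_natural])
    also have "\<dots> = ?ev \<cdot> ((\<Psi> \<cdot> ?B X T) \<boxtimes> F) \<cdot> inv_arr C (?a X T T) \<cdot> (\<I> X \<boxtimes> ?B T T)"
      by (simp add: interchange_reduce ev_F)
    also have "\<dots> = ?ev \<cdot> (\<I> X \<boxtimes> F) \<cdot> (\<Psi> \<boxtimes> \<I> T) \<cdot> (?B X T \<boxtimes> \<I> T) \<cdot> inv_arr C (?a X T T)
        \<cdot> (\<I> X \<boxtimes> ?B T T)"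
      by (simp add: interchange_reduce)
    also have "\<dots> = \<Psi> \<cdot> ?B X T \<cdot> (\<Psi> \<boxtimes> \<I> T) \<cdot> (?B X T \<boxtimes> \<I> T) \<cdot> inv_arr C (?a X T T)
        \<cdot> (\<I> X \<boxtimes> ?B T T)"
      by (simp add: Comp_reduce[OF ev_F])
    also have "\<dots> = \<Psi> \<cdot> (\<I> T \<boxtimes> \<Psi>) \<cdot> ?B (T \<otimes> X) T \<cdot> (?B X T \<boxtimes> \<I> T) \<cdot> inv_arr C (?a X T T)
        \<cdot> (\<I> X \<boxtimes> ?B T T)"
      by (simp add: Comp_reduce[OF Braiding_natural_Arr])
    also have "\<dots> = \<Psi> \<cdot> (\<I> T \<boxtimes> \<Psi>) \<cdot> ?a T T X \<cdot> (?B T T \<boxtimes> \<I> X) \<cdot> ?B X (T \<otimes> T)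
        \<cdot> ?a X T T \<cdot> inv_arr C (?a X T T) \<cdot> (\<I> X \<boxtimes> ?B T T)"
      by (simp add: Comp_reduce[OF Braiding_reversal] del: inv_arr_simps(4))
    also have "\<dots> = \<Psi> \<cdot> (\<I> T \<boxtimes> \<Psi>) \<cdot> ?a T T X \<cdot> (?B T T \<boxtimes> \<I> X) \<cdot> ?B X (T \<otimes> T) \<cdot> (\<I> X \<boxtimes> ?B T T)"
      by (simp add: Comp_reduce[OF inv_arr_simps(4)])
    also have "\<dots> = \<Psi> \<cdot> (\<I> T \<boxtimes> \<Psi>) \<cdot> ?a T T X \<cdot> ?B X (T \<otimes> T)"
      by (simp add: Braiding_natural_Arr interchange_reduce)
    also have "\<dots> = (\<Psi> \<cdot> (\<I> T \<boxtimes> \<Psi>) \<cdot> ?a T T X) \<cdot> ?B X (T \<otimes> T)"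
      by simp
    also have "\<dots> = \<Psi> \<cdot> ?B X T \<cdot> (\<I> X \<boxtimes> \<mu>)"
      unfolding act_comp by (simp add: Braiding_natural_Arr)
    also have "\<dots> = ?ev \<cdot> (\<I> X \<boxtimes> F) \<cdot> (\<I> X \<boxtimes> \<mu>)"
      by (simp add: Comp_reduce[OF ev_F])
    also have "\<dots> = ?ev \<cdot> (\<I> X \<boxtimes> (F \<cdot> \<mu>))"
      by (simp add: interchange)
    finally show ?case by (rule sym)
  qed (simp_all add: Hom_iff)
qed

lemma left_action_imp_ex1_enriched_functor:
  assumes A: "enriched_category C A" and s: "EObj A = {s}"
    and act: "left_action C (EHom A s s) (EComp A s s s) (EId A s) X \<Psi>"
  shows "\<exists>!F. enriched_functor C A (self_enrichment C) F \<and> FObj F s = X \<and>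
    adjoint_action C (EHom A s s) X (FHom F s s) = \<Psi>"
proof -
  interpret A: enriched_category C A
    by (fact A)
  let ?T = "EHom A s s"
  have T [simp]: "?T \<in> Obj C"
    using s by (simp add: A.EHom_closed)
  have \<mu>: "EComp A s s s \<in> Hom C (?T \<otimes> ?T) ?T" and \<iota>: "EId A s \<in> Hom C \<one> ?T"
    using s by (simp_all add: A.EComp_in_Hom A.EId_in_Hom)
  have X [simp]: "X \<in> Obj C" and \<Psi>: "\<Psi> \<in> Hom C (?T \<otimes> X) X"
    using act by (simp_all add: left_action_def)
  define f where "f = Curry C X ?T X (\<Psi> \<cdot> Braiding C X ?T)"
  have f: "f \<in> Hom C ?T [X; X]"
    using \<Psi> by (simp add: f_def Hom_iff)
  have adj: "adjoint_action C ?T X f = \<Psi>"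
    using \<Psi> unfolding f_def adjoint_action_def by (simp add: Uncurry_Curry Hom_iff)
  \<comment> \<open>Outside the only object, both components take the default values required of a functor.\<close>
  define F :: "('a, 'o, 'm) enriched_functor" where
    "F = \<lparr>FObj = \<lambda>a\<in>{s}. X, FHom = \<lambda>a b. if a = s \<and> b = s then f else undefined\<rparr>"
  show ?thesis
  proof (rule ex1I[of _ F])
    have "f \<cdot> EId A s = EId (self_enrichment C) X"
      by (rule left_action_imp_unit[OF X f \<mu> \<iota> act[folded adj]])
    moreover have "f \<cdot> EComp A s s s = EComp (self_enrichment C) X X X \<cdot> (f \<boxtimes> f)"
      by (rule left_action_imp_comp[OF X f \<mu> \<iota> act[folded adj]])
    moreover have "EObj (self_enrichment C) = Obj C" and "EHom (self_enrichment C) = Ihom C"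
      by (simp_all add: self_enrichment_def)
    ultimately show "enriched_functor C A (self_enrichment C) F \<and> FObj F s = X \<and>
        adjoint_action C ?T X (FHom F s s) = \<Psi>"
      using s f adj by (auto simp: enriched_functor_def F_def)
  next
    fix G
    assume G: "enriched_functor C A (self_enrichment C) G \<and> FObj G s = X \<and>
        adjoint_action C ?T X (FHom G s s) = \<Psi>"
    then have G': "FObj G \<in> extensional {s}" "\<And>a b. a \<noteq> s \<or> b \<noteq> s \<Longrightarrow> FHom G a b = undefined"
      "FHom G s s \<in> Hom C ?T [X; X]"
      using s by (auto simp: enriched_functor_def self_enrichment_def PiE_def)
    have "FHom G s s = f"
      using T X G'(3) f by (rule adjoint_action_inj) (simp add: G adj)
    then have "FHom G = FHom F"
      using G'(2) by (auto simp: F_def fun_eq_iff)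
    moreover have "FObj G = FObj F"
      using G G'(1) by (auto simp: F_def intro!: extensionalityI[of _ "{s}"])
    ultimately show "G = F"
      by simp
  qed
qed

end

section \<open>The functor of the shift\<close>

theorem theorem1:
  fixes C :: "('o, 'm, 'e) closed_symmetric_monoidal_category_scheme"
    and \<T> :: "('a, 'o, 'm) enriched_category"
    and s :: 'a and T \<Omega> :: 'o and \<mu> \<iota> :: 'm
  assumes "closed_symmetric_monoidal_category C"
    and "enriched_category C \<T>"
    and "EObj \<T> = {s}"
    and "T = EHom \<T> s s"
    and "\<mu> = EComp \<T> s s s"
    and "\<iota> = EId \<T> s"
    and "\<Omega> \<in> Obj C"
  shows "left_action C T \<mu> \<iota> [T; \<Omega>]\<^bsub>C\<^esub> (shift C T \<mu> \<Omega>) \<and>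
    (\<exists>!F. enriched_functor C \<T> (self_enrichment C) F \<and>
          FObj F s = [T; \<Omega>]\<^bsub>C\<^esub> \<and>
          adjoint_action C T [T; \<Omega>]\<^bsub>C\<^esub> (FHom F s s) = shift C T \<mu> \<Omega>)"
proof -
  interpret closed_symmetric_monoidal_category C
    by (fact assms(1))
  interpret T: enriched_category C \<T>
    by (fact assms(2))
  have s: "s \<in> EObj \<T>"
    using assms(3) by simp
  have action: "left_action C T \<mu> \<iota> [T; \<Omega>]\<^bsub>C\<^esub> (shift C T \<mu> \<Omega>)"
    unfolding assms(4-6)
    by (rule left_action_shift[OF T.EHom_closed[OF s s] assms(7) T.EComp_in_Hom[OF s s s]
          T.EId_in_Hom[OF s] T.EComp_assoc[OF s s s s] T.EComp_EId_right[OF s s]])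
  with left_action_imp_ex1_enriched_functor[OF assms(2,3), folded assms(4-6), OF action]
  show ?thesis
    by (rule conjI[rotated])
qed

end
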